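(* For any integers $a\geq 3$ and $b\geq 1$, the tadpole graph $T^{\langle a,b\rangle}$ is $e$-positive.
   Context: For a finite simple graph $G$ with vertex set $\{v_1,\dots,v_d\}$, the chromatic symmetric function is $X_G=\sum_{\kappa} x_{\kappa(v_1)}x_{\kappa(v_2)}\cdots x_{\kappa(v_d)}$, where the sum ranges over all proper colorings $\kappa:V(G)\to\{1,2,3,\dots\}$ (adjacent vertices receive different colors), and $x_1,x_2,\dots$ are commuting indeterminates. $G$ is called $e$-positive if all coefficients in the expansion of $X_G$ in the basis of elementary symmetric functions $e_\lambda=e_{\lambda_1}e_{\lambda_2}\cdots$ are non-negative. For $a\ge 3$, $b\ge 1$, the $(a,b)$-tadpole graph $T^{\langle a,b\rangle}$ is the graph on vertices $v_1,\dots,v_{a+b}$ obtained by taking the cycle $v_1v_2\cdots v_a v_1$ and the path $v_{a+1}v_{a+2}\cdots v_{a+b}$ and adding the edge $v_av_{a+1}$. *)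

theory Defs
  imports Complex_Main "HOL-Library.Multiset" "HOL-Library.FuncSet"
begin

section \<open>Formal power series in countably many commuting indeterminates\<close>

text \<open>
  A monomial is a finite multiset of indices, \<open>M\<close> standing for the product of the
  \<open>x\<^sub>i\<close> with \<open>i\<close> ranging over \<open>M\<close> (with multiplicity).  A formal power series with
  integer coefficients is an arbitrary assignment of coefficients to monomials.
  Only the indeterminates with index at least 1 are used below.
\<close>

typedef mfps = "UNIV :: (nat multiset \<Rightarrow> int) set"
  morphisms mcoeff Abs_mfps ..

lemma mcoeff_Abs [simp]: "mcoeff (Abs_mfps f) = f"
  by (simp add: Abs_mfps_inverse)

lemma mfps_eqI: "(\<And>M. mcoeff f M = mcoeff g M) \<Longrightarrow> f = g"
  by (metis ext mcoeff_inject)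

definition msplits :: "nat multiset \<Rightarrow> (nat multiset \<times> nat multiset) set" where
  "msplits M = {(A, B). A + B = M}"

lemma finite_msplits [simp]: "finite (msplits M)"
proof -
  have "msplits M \<subseteq> {A. A \<subseteq># M} \<times> {A. A \<subseteq># M}"
    by (auto simp: msplits_def)
  moreover have "finite {A. A \<subseteq># M}"
  proof (rule finite_subset)
    show "{A. A \<subseteq># M} \<subseteq> (\<Union>n\<le>size M. multisets_of_size (set_mset M) n)"
      by (auto simp: multisets_of_size_def size_mset_mono dest: mset_subset_eqD)
    show "finite (\<Union>n\<le>size M. multisets_of_size (set_mset M) n)"
      by auto
  qed
  ultimately show ?thesis
    by (meson finite_SigmaI finite_subset)
qed

instantiation mfps :: comm_ring_1
begin

definition "0 = Abs_mfps (\<lambda>_. 0)"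
definition "1 = Abs_mfps (\<lambda>M. if M = {#} then 1 else 0)"
definition "f + g = Abs_mfps (\<lambda>M. mcoeff f M + mcoeff g M)"
definition "f - g = Abs_mfps (\<lambda>M. mcoeff f M - mcoeff g M)"
definition "- f = Abs_mfps (\<lambda>M. - mcoeff f M)"
definition "f * g = Abs_mfps (\<lambda>M. \<Sum>(A, B)\<in>msplits M. mcoeff f A * mcoeff g B)"

instance
proof
  fix f g h :: mfps
  note defs = zero_mfps_def one_mfps_def plus_mfps_def minus_mfps_def uminus_mfps_def
    times_mfps_def
  show "f + g + h = f + (g + h)" "f + g = g + f" "0 + f = f" "- f + f = 0" "f - g = f + - g"
    by (auto intro!: mfps_eqI simp: defs)
  show "(0::mfps) \<noteq> 1"
  proof
    assume "(0::mfps) = 1"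
    hence "mcoeff 0 {#} = mcoeff 1 {#}" by simp
    thus False by (simp add: defs)
  qed
  show "f * g = g * f"
  proof (rule mfps_eqI)
    fix M
    show "mcoeff (f * g) M = mcoeff (g * f) M"
      unfolding defs mcoeff_Abs
      by (rule sum.reindex_bij_witness[where i = "\<lambda>(A,B). (B,A)" and j = "\<lambda>(A,B). (B,A)"])
         (auto simp: msplits_def add.commute mult.commute)
  qed
  show "(f + g) * h = f * h + g * h"
    by (rule mfps_eqI) (simp add: defs distrib_right sum.distrib case_prod_unfold)
  show "1 * f = f"
  proof (rule mfps_eqI)
    fix M
    have "mcoeff (1 * f) M = (\<Sum>(A, B)\<in>msplits M. (if A = {#} then 1 else 0) * mcoeff f B)"
      by (simp add: defs)
    also have "\<dots> = (\<Sum>(A, B)\<in>{({#} :: nat multiset, M)}. (if A = {#} then 1 else 0) * mcoeff f B)"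
      by (rule sum.mono_neutral_right) (simp, auto simp: msplits_def split: if_splits)
    finally show "mcoeff (1 * f) M = mcoeff f M" by simp
  qed
  show "f * g * h = f * (g * h)"
  proof (rule mfps_eqI)
    fix M
    have "mcoeff (f * g * h) M =
        (\<Sum>p\<in>msplits M. \<Sum>q\<in>msplits (fst p). mcoeff f (fst q) * mcoeff g (snd q) * mcoeff h (snd p))"
      by (simp add: defs sum_distrib_right case_prod_unfold)
    also have "\<dots> = (\<Sum>(p, q)\<in>Sigma (msplits M) (\<lambda>p. msplits (fst p)).
        mcoeff f (fst q) * mcoeff g (snd q) * mcoeff h (snd p))"
      by (rule sum.Sigma) auto
    also have "\<dots> = (\<Sum>(p, q)\<in>Sigma (msplits M) (\<lambda>p. msplits (snd p)).
        mcoeff f (fst p) * (mcoeff g (fst q) * mcoeff h (snd q)))"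
      by (rule sum.reindex_bij_witness[where
            i = "\<lambda>(p, q). ((fst p + fst q, snd q), (fst p, fst q))" and
            j = "\<lambda>(p, q). ((fst q, snd q + snd p), (snd q, snd p))"])
         (auto simp: msplits_def add.assoc mult.assoc)
    also have "\<dots> = (\<Sum>p\<in>msplits M. \<Sum>q\<in>msplits (snd p).
        mcoeff f (fst p) * (mcoeff g (fst q) * mcoeff h (snd q)))"
      by (rule sum.Sigma[symmetric]) auto
    also have "\<dots> = mcoeff (f * (g * h)) M"
      by (simp add: defs sum_distrib_left case_prod_unfold)
    finally show "mcoeff (f * g * h) M = mcoeff (f * (g * h)) M" .
  qed
qed

end

lemma mcoeff_0 [simp]: "mcoeff 0 M = 0"
  and mcoeff_1: "mcoeff 1 M = (if M = {#} then 1 else 0)"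
  and mcoeff_add [simp]: "mcoeff (f + g) M = mcoeff f M + mcoeff g M"
  and mcoeff_diff [simp]: "mcoeff (f - g) M = mcoeff f M - mcoeff g M"
  and mcoeff_uminus [simp]: "mcoeff (- f) M = - mcoeff f M"
  and mcoeff_mult: "mcoeff (f * g) M = (\<Sum>(A, B)\<in>msplits M. mcoeff f A * mcoeff g B)"
  by (simp_all add: zero_mfps_def one_mfps_def plus_mfps_def minus_mfps_def uminus_mfps_def
      times_mfps_def)

lemma mcoeff_sum [simp]: "mcoeff (sum f A) M = (\<Sum>x\<in>A. mcoeff (f x) M)"
  by (induction A rule: infinite_finite_induct) auto

lemma mcoeff_of_int_mult [simp]: "mcoeff (of_int c * f) M = c * mcoeff f M"
proof -
  have nat: "mcoeff (of_nat n * f) M = int n * mcoeff f M" for n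
    by (induction n) (simp_all add: distrib_right)
  show ?thesis
    by (cases c) (simp_all add: nat distrib_right left_diff_distrib)
qed

text \<open>
  \<open>msum A w\<close> is the formal sum, over all \<open>k \<in> A\<close>, of the monomials \<open>w k\<close>.  The set \<open>A\<close> may be
  infinite, but each monomial must arise from only finitely many \<open>k \<in> A\<close>.
\<close>

definition msum :: "'k set \<Rightarrow> ('k \<Rightarrow> nat multiset) \<Rightarrow> mfps" where
  "msum A w = Abs_mfps (\<lambda>M. int (card {k \<in> A. w k = M}))"


section \<open>Elementary symmetric functions and e-positivity\<close>

definition esym :: "nat \<Rightarrow> mfps" where
  "esym k = msum {S. finite S \<and> S \<subseteq> {1..} \<and> card S = k} mset_set"

text \<open>Integer partitions are finite multisets of positive integers.\<close>

definition is_partition :: "nat multiset \<Rightarrow> bool" where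
  "is_partition \<rho> \<longleftrightarrow> 0 \<notin># \<rho>"

definition esym_part :: "nat multiset \<Rightarrow> mfps" where
  "esym_part \<rho> = (\<Prod>k\<in>#\<rho>. esym k)"

definition e_expansion :: "mfps \<Rightarrow> (nat multiset \<Rightarrow> int) \<Rightarrow> bool" where
  "e_expansion f c \<longleftrightarrow>
     finite {\<rho>. c \<rho> \<noteq> 0} \<and> (\<forall>\<rho>. c \<rho> \<noteq> 0 \<longrightarrow> is_partition \<rho>) \<and>
     f = (\<Sum>\<rho> | c \<rho> \<noteq> 0. of_int (c \<rho>) * esym_part \<rho>)"

text \<open>
  The coefficients \<open>c\<close> are determined by \<open>f\<close>, see \<open>e_expansion_unique\<close> below.
\<close>

definition e_positive :: "mfps \<Rightarrow> bool" where
  "e_positive f \<longleftrightarrow> (\<exists>c. e_expansion f c \<and> (\<forall>\<rho>. c \<rho> \<ge> 0))"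


section \<open>Graphs and chromatic symmetric functions\<close>

text \<open>A graph is a pair of its vertex set and its set of (unordered) edges.\<close>

type_synonym 'v graph = "'v set \<times> 'v set set"

definition finite_simple_graph :: "'v graph \<Rightarrow> bool" where
  "finite_simple_graph G \<longleftrightarrow> finite (fst G) \<and> (\<forall>e\<in>snd G. e \<subseteq> fst G \<and> card e = 2)"

definition proper_colorings :: "'v graph \<Rightarrow> ('v \<Rightarrow> nat) set" where
  "proper_colorings G =
     {\<kappa> \<in> fst G \<rightarrow>\<^sub>E {1..}. \<forall>u v. {u, v} \<in> snd G \<longrightarrow> \<kappa> u \<noteq> \<kappa> v}"

definition chromatic_symmetric_function :: "'v graph \<Rightarrow> mfps" where
  "chromatic_symmetric_function G =
     msum (proper_colorings G) (\<lambda>\<kappa>. image_mset \<kappa> (mset_set (fst G)))"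

definition e_positive_graph :: "'v graph \<Rightarrow> bool" where
  "e_positive_graph G \<longleftrightarrow> e_positive (chromatic_symmetric_function G)"

definition tadpole :: "nat \<Rightarrow> nat \<Rightarrow> nat graph" where
  "tadpole a b =
     ({1..a + b},
      {{i, i + 1} | i. 1 \<le> i \<and> i < a} \<union> {{a, 1}} \<union>
      {{i, i + 1} | i. a + 1 \<le> i \<and> i < a + b} \<union> {{a, a + 1}})"


section \<open>Well-definedness\<close>

lemma tadpole_finite_simple_graph:
  assumes "a \<ge> 3" "b \<ge> 1"
  shows "finite_simple_graph (tadpole a b)"
  using assms by (auto simp: finite_simple_graph_def tadpole_def)

lemma finite_colorings_with_monomial:
  assumes "finite (fst G)"
  shows "finite {\<kappa> \<in> proper_colorings G. image_mset \<kappa> (mset_set (fst G)) = M}"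
proof (rule finite_subset)
  show "{\<kappa> \<in> proper_colorings G. image_mset \<kappa> (mset_set (fst G)) = M}
      \<subseteq> (fst G \<rightarrow>\<^sub>E set_mset M)"
    using assms by (auto simp: proper_colorings_def PiE_iff extensional_def)
  show "finite (fst G \<rightarrow>\<^sub>E set_mset M)"
    using assms by (intro finite_PiE) auto
qed

lemma mcoeff_esym:
  "mcoeff (esym k) M =
     (if \<exists>S. finite S \<and> S \<subseteq> {1..} \<and> card S = k \<and> M = mset_set S then 1 else 0)"
proof (cases "\<exists>S. finite S \<and> S \<subseteq> {1..} \<and> card S = k \<and> M = mset_set S")
  case True
  then obtain S where "finite S" "S \<subseteq> {1..}" "card S = k" "M = mset_set S" by blast
  hence "{T \<in> {S. finite S \<and> S \<subseteq> {1..} \<and> card S = k}. mset_set T = M} = {S}"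
    by (auto simp: mset_set_eq_iff)
  with True show ?thesis by (simp add: esym_def msum_def)
next
  case False
  hence "{T \<in> {S. finite S \<and> S \<subseteq> {1..} \<and> card S = k}. mset_set T = M} = {}"
    by auto
  hence "card {T \<in> {S. finite S \<and> S \<subseteq> {1..} \<and> card S = k}. mset_set T = M} = 0"
    by (metis card.empty)
  with False show ?thesis by (simp only: esym_def msum_def mcoeff_Abs) simp
qed

text \<open>
  Uniqueness of e-expansions: the lexicographically leading monomial of \<open>esym_part \<rho>\<close> has
  exponents given by the conjugate partition of \<open>\<rho>\<close>.
\<close>

definition mless :: "nat multiset \<Rightarrow> nat multiset \<Rightarrow> bool" where
  "mless M N \<longleftrightarrow> (\<exists>i. count M i < count N i \<and> (\<forall>j<i. count M j = count N j))"

lemma mless_irrefl: "\<not> mless M M"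
  by (auto simp: mless_def)

lemma mless_trans: "mless M N \<Longrightarrow> mless N P \<Longrightarrow> mless M P"
  unfolding mless_def
proof (elim exE conjE)
  fix i k
  assume *: "count M i < count N i" "\<forall>j<i. count M j = count N j"
    "count N k < count P k" "\<forall>j<k. count N j = count P j"
  show "\<exists>i. count M i < count P i \<and> (\<forall>j<i. count M j = count P j)"
    using * by (intro exI[of _ "min i k"]) (cases i k rule: linorder_cases; auto simp: min_def)
qed

lemma mless_total: "M \<noteq> N \<Longrightarrow> mless M N \<or> mless N M"
proof -
  assume "M \<noteq> N"
  hence ex: "\<exists>i. count M i \<noteq> count N i" by (auto simp: multiset_eq_iff)
  define i where "i = (LEAST i. count M i \<noteq> count N i)"
  have "count M i \<noteq> count N i" unfolding i_def using ex by (rule LeastI_ex)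
  moreover have "\<forall>j<i. count M j = count N j"
    unfolding i_def using not_less_Least by blast
  ultimately show ?thesis unfolding mless_def by (metis linorder_neqE_nat)
qed

lemma mless_add_right: "mless M N \<Longrightarrow> mless (M + P) (N + P)"
  by (auto simp: mless_def)

lemma mless_add:
  assumes "M = N \<or> mless M N" "M' = N' \<or> mless M' N'" "\<not> (M = N \<and> M' = N')"
  shows "mless (M + M') (N + N')"
proof -
  have left: "mless (N + M') (N + N')" if "mless M' N'"
    using mless_add_right[OF that, of N] by (simp add: add.commute)
  have right: "mless (M + M') (N + M')" if "mless M N"
    using mless_add_right[OF that] .
  show ?thesis
    using assms left right mless_trans[of "M + M'" "N + M'" "N + N'"] by auto
qed

definition elead :: "nat multiset \<Rightarrow> nat multiset" where
  "elead \<rho> = (\<Sum>k\<in>#\<rho>. mset_set {1..k})"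

lemma mcoeff_esym_lead: "mcoeff (esym k) (mset_set {1..k}) = 1"
proof -
  have "\<exists>S. finite S \<and> S \<subseteq> {1..} \<and> card S = k \<and> mset_set {1..k} = mset_set S"
    by (rule exI[of _ "{1..k}"]) auto
  thus ?thesis by (simp add: mcoeff_esym)
qed

lemma mcoeff_esym_le_lead:
  assumes "mcoeff (esym k) M \<noteq> 0"
  shows "M = mset_set {1..k} \<or> mless M (mset_set {1..k})"
proof -
  from assms obtain S where S: "finite S" "S \<subseteq> {1..}" "card S = k" "M = mset_set S"
    by (auto simp: mcoeff_esym split: if_splits)
  show ?thesis
  proof (cases "{1..k} \<subseteq> S")
    case True
    hence "S = {1..k}" using S by (metis card_atLeastAtMost card_subset_eq diff_Suc_1)
    with S show ?thesis by simp
  next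
    case False
    hence ex: "\<exists>i. i \<in> {1..k} \<and> i \<notin> S" by blast
    define i where "i = (LEAST i. i \<in> {1..k} \<and> i \<notin> S)"
    have i: "i \<in> {1..k} \<and> i \<notin> S" unfolding i_def using ex by (rule LeastI_ex)
    have below: "j \<in> {1..k} \<longrightarrow> j \<in> S" if "j < i" for j
      using not_less_Least[OF that[unfolded i_def]] by blast
    have "count M j = count (mset_set {1..k}) j" if "j < i" for j
      using below[OF that] that i S by (cases "j = 0") (auto simp: count_mset_set')
    moreover have "count M i < count (mset_set {1..k}) i"
      using i S by (simp add: count_mset_set')
    ultimately show ?thesis unfolding mless_def by blast
  qed
qed

lemma mcoeff_esym_part:
  shows mcoeff_esym_part_lead: "mcoeff (esym_part \<rho>) (elead \<rho>) = 1"
    and mcoeff_esym_part_le_lead: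
      "mcoeff (esym_part \<rho>) M \<noteq> 0 \<Longrightarrow> M = elead \<rho> \<or> mless M (elead \<rho>)"
proof (induction \<rho> arbitrary: M)
  case empty
  {
    case 1 show ?case by (simp add: esym_part_def elead_def mcoeff_1)
  next
    case 2 thus ?case by (simp add: esym_part_def elead_def mcoeff_1 split: if_splits)
  }
next
  case (add k \<rho>)
  have prod: "esym_part (add_mset k \<rho>) = esym k * esym_part \<rho>"
    by (simp add: esym_part_def)
  have lead: "elead (add_mset k \<rho>) = mset_set {1..k} + elead \<rho>"
    by (simp add: elead_def)
  {
    case 1
    have "mcoeff (esym_part (add_mset k \<rho>)) (elead (add_mset k \<rho>)) =
        (\<Sum>(A, B)\<in>msplits (mset_set {1..k} + elead \<rho>). mcoeff (esym k) A * mcoeff (esym_part \<rho>) B)"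
      by (simp only: prod lead mcoeff_mult)
    also have "\<dots> = (\<Sum>(A, B)\<in>{(mset_set {1..k}, elead \<rho>)}.
        mcoeff (esym k) A * mcoeff (esym_part \<rho>) B)"
    proof (rule sum.mono_neutral_right)
      show "\<forall>p\<in>msplits (mset_set {1..k} + elead \<rho>) - {(mset_set {1..k}, elead \<rho>)}.
          (case p of (A, B) \<Rightarrow> mcoeff (esym k) A * mcoeff (esym_part \<rho>) B) = 0"
      proof (clarify, rule ccontr)
        fix A B
        assume *: "(A, B) \<in> msplits (mset_set {1..k} + elead \<rho>)"
          "(A, B) \<notin> {}" "\<not> (A = mset_set {1..k} \<and> B = elead \<rho>)"
          "mcoeff (esym k) A * mcoeff (esym_part \<rho>) B \<noteq> 0"
        hence "mless (A + B) (mset_set {1..k} + elead \<rho>)"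
          using mcoeff_esym_le_lead[of k A] add.IH(2)[of B] by (intro mless_add) auto
        with * show False by (simp add: msplits_def mless_irrefl)
      qed
    qed (simp, simp add: msplits_def)
    finally show ?case using add.IH(1) mcoeff_esym_lead by simp
  next
    case 2
    then obtain A B where "A + B = M" "mcoeff (esym k) A \<noteq> 0" "mcoeff (esym_part \<rho>) B \<noteq> 0"
      unfolding prod mcoeff_mult
      by (auto simp: msplits_def elim!: sum.not_neutral_contains_not_neutral)
    thus ?case
      using mcoeff_esym_le_lead[of k A] add.IH(2)[of B]
        mless_add[of A "mset_set {1..k}" B "elead \<rho>"]
      unfolding lead by blast
  }
qed

lemma count_elead: "i \<ge> 1 \<Longrightarrow> count (elead \<rho>) i = size (filter_mset (\<lambda>k. i \<le> k) \<rho>)"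
  by (induction \<rho>) (auto simp: elead_def count_mset_set')

lemma elead_inj:
  assumes "is_partition \<rho>" "is_partition \<mu>" "elead \<rho> = elead \<mu>"
  shows "\<rho> = \<mu>"
proof (rule multiset_eqI)
  fix i
  have *: "size (filter_mset (\<lambda>k. i \<le> k) \<nu>) = count \<nu> i + size (filter_mset (\<lambda>k. Suc i \<le> k) \<nu>)"
    for \<nu> :: "nat multiset"
    by (induction \<nu>) auto
  show "count \<rho> i = count \<mu> i"
  proof (cases "i = 0")
    case True
    with assms show ?thesis by (simp add: is_partition_def not_in_iff)
  next
    case False
    with *[of \<rho>] *[of \<mu>] count_elead[of i] count_elead[of "Suc i"] assms(3)
    show ?thesis by (metis add_right_cancel le_add1 less_one linorder_not_less plus_1_eq_Suc)
  qed
qed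

lemma mless_max_exists:
  assumes "finite A" "A \<noteq> {}"
  shows "\<exists>m\<in>A. \<forall>x\<in>A. \<not> mless m x"
  using assms
proof (induction A rule: finite_ne_induct)
  case (singleton x)
  thus ?case by (auto simp: mless_irrefl)
next
  case (insert x F)
  then obtain m where m: "m \<in> F" "\<forall>x\<in>F. \<not> mless m x" by blast
  show ?case
  proof (cases "mless m x")
    case True
    thus ?thesis using m mless_trans mless_irrefl by (metis insert_iff)
  next
    case False
    thus ?thesis using m by blast
  qed
qed

lemma esym_part_independent:
  assumes "finite A" "\<forall>\<rho>\<in>A. is_partition \<rho>" "(\<Sum>\<rho>\<in>A. of_int (c \<rho>) * esym_part \<rho>) = 0"
    and "\<mu> \<in> A"
  shows "c \<mu> = 0"
proof (rule ccontr)
  assume "c \<mu> \<noteq> 0"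
  define B where "B = {\<rho>\<in>A. c \<rho> \<noteq> 0}"
  have "finite (elead ` B)" "elead ` B \<noteq> {}"
    using assms(1,4) \<open>c \<mu> \<noteq> 0\<close> by (auto simp: B_def)
  from mless_max_exists[OF this] obtain \<nu> where \<nu>: "\<nu> \<in> B"
    "\<forall>\<rho>\<in>B. \<not> mless (elead \<nu>) (elead \<rho>)"
    by blast
  have "0 = mcoeff (\<Sum>\<rho>\<in>A. of_int (c \<rho>) * esym_part \<rho>) (elead \<nu>)"
    using assms(3) by simp
  also have "\<dots> = (\<Sum>\<rho>\<in>A. c \<rho> * mcoeff (esym_part \<rho>) (elead \<nu>))"
    by simp
  also have "\<dots> = (\<Sum>\<rho>\<in>{\<nu>}. c \<rho> * mcoeff (esym_part \<rho>) (elead \<nu>))"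
  proof (rule sum.mono_neutral_right)
    show "\<forall>\<rho>\<in>A - {\<nu>}. c \<rho> * mcoeff (esym_part \<rho>) (elead \<nu>) = 0"
    proof (rule ballI, rule ccontr)
      fix \<rho>
      assume *: "\<rho> \<in> A - {\<nu>}" "c \<rho> * mcoeff (esym_part \<rho>) (elead \<nu>) \<noteq> 0"
      hence "\<rho> \<in> B" by (auto simp: B_def)
      with * \<nu> mcoeff_esym_part_le_lead[of \<rho> "elead \<nu>"] have "elead \<nu> = elead \<rho>" by auto
      with elead_inj[of \<nu> \<rho>] * \<nu>(1) assms(2) show False by (auto simp: B_def)
    qed
  qed (use \<nu> assms(1) in \<open>auto simp: B_def\<close>)
  also have "\<dots> = c \<nu>" by (simp add: mcoeff_esym_part_lead)
  finally show False using \<nu>(1) by (simp add: B_def)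
qed

lemma e_expansion_unique:
  assumes "e_expansion f c" "e_expansion f c'"
  shows "c = c'"
proof
  fix \<mu>
  define A where "A = {\<rho>. c \<rho> \<noteq> 0} \<union> {\<rho>. c' \<rho> \<noteq> 0}"
  have fin: "finite A" and part: "\<forall>\<rho>\<in>A. is_partition \<rho>"
    using assms by (auto simp: A_def e_expansion_def)
  have "f = (\<Sum>\<rho>\<in>A. of_int (c \<rho>) * esym_part \<rho>)"
    using assms(1) fin unfolding e_expansion_def
    by (auto simp: A_def intro!: sum.mono_neutral_left)
  moreover have "f = (\<Sum>\<rho>\<in>A. of_int (c' \<rho>) * esym_part \<rho>)"
    using assms(2) fin unfolding e_expansion_def
    by (auto simp: A_def intro!: sum.mono_neutral_left)
  ultimately have "(\<Sum>\<rho>\<in>A. of_int (c \<rho>) * esym_part \<rho>) = (\<Sum>\<rho>\<in>A. of_int (c' \<rho>) * esym_part \<rho>)"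
    by simp
  hence "(\<Sum>\<rho>\<in>A. of_int (c \<rho> - c' \<rho>) * esym_part \<rho>) = 0"
    by (simp add: left_diff_distrib sum_subtractf)
  from esym_part_independent[OF fin part this, of \<mu>] show "c \<mu> = c' \<mu>"
    by (cases "\<mu> \<in> A") (auto simp: A_def)
qed

end

theory Submission
  imports Defs
begin

text \<open>
  Write \<open>P\<^sub>n\<close> for the chromatic symmetric function of the path with \<open>n\<close> vertices and \<open>T(a, n)\<close> for
  that of the tadpole with \<open>n\<close> vertices, \<open>a\<close> of them on the cycle.  A bijection on pairs of a set
  and a proper word gives \<open>P\<^sub>n = e\<^sub>n + \<Sum>\<^sub>k (k - 1) e\<^sub>k P\<^bsub>n - k\<^esub>\<close>.  Triple deletion gives
  \<open>T(a + 1, n) = T(a, n) - T(a, a) P\<^bsub>n - a\<^esub> + P\<^sub>n\<close>, and \<open>T(1, n) = 0\<close>, so all \<open>T(a, n)\<close> are determined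
  by the \<open>P\<^sub>n\<close>.  The negative terms cancel in the recurrence
  \<open>T(a, n) = \<Sum>\<^bsub>k < a\<^esub> (k - 1) e\<^sub>k T(a - k, n - k) + (a - 1) (e\<^sub>n + \<Sum>\<^bsub>a \<le> k \<le> n\<^esub> (k - 1) e\<^sub>k P\<^bsub>n - k\<^esub>)\<close>,
  proved by induction on \<open>a\<close>: the case \<open>n = a\<close> is the recurrence for cycles that the larger
  values of \<open>a\<close> rely on.
\<close>

section \<open>Formal sums of monomials\<close>

text \<open>\<open>card\<close> sends infinite sets to 0, so without this condition
  \<open>msum\<close> need not respect disjoint unions or products.\<close>

definition finite_fibres :: "'k set \<Rightarrow> ('k \<Rightarrow> nat multiset) \<Rightarrow> bool" where
  "finite_fibres A w \<longleftrightarrow> (\<forall>M. finite {k \<in> A. w k = M})"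

lemma mcoeff_msum: "mcoeff (msum A w) M = int (card {k \<in> A. w k = M})"
  by (simp add: msum_def)

lemma msum_empty [simp]: "msum {} w = 0"
  by (rule mfps_eqI) (simp add: mcoeff_msum)

lemma msum_cong_bij:
  assumes "bij_betw h A B" "\<And>x. x \<in> A \<Longrightarrow> v (h x) = w x"
  shows "msum A w = msum B v"
proof (rule mfps_eqI)
  fix M
  have "bij_betw h {k \<in> A. w k = M} {k \<in> B. v k = M}"
    using assms by (fastforce simp: bij_betw_def inj_on_def)
  thus "mcoeff (msum A w) M = mcoeff (msum B v) M"
    by (simp add: mcoeff_msum bij_betw_same_card)
qed

lemma msum_Un_disjoint:
  assumes "finite_fibres (A \<union> B) w" "A \<inter> B = {}"
  shows "msum (A \<union> B) w = msum A w + msum B w"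
proof (rule mfps_eqI)
  fix M
  have fin: "finite {k \<in> A \<union> B. w k = M}"
    using assms(1) by (simp add: finite_fibres_def)
  have "card {k \<in> A \<union> B. w k = M} = card ({k \<in> A. w k = M} \<union> {k \<in> B. w k = M})"
    by (rule arg_cong[where f = card]) auto
  also have "\<dots> = card {k \<in> A. w k = M} + card {k \<in> B. w k = M}"
    using fin assms(2) by (intro card_Un_disjoint) (auto elim: rev_finite_subset)
  finally show "mcoeff (msum (A \<union> B) w) M = mcoeff (msum A w + msum B w) M"
    by (simp add: mcoeff_msum)
qed

lemma msum_split:
  assumes "finite_fibres A w"
  shows "msum A w = msum {x \<in> A. Q x} w + msum {x \<in> A. \<not> Q x} w"
proof -
  have "A = {x \<in> A. Q x} \<union> {x \<in> A. \<not> Q x}" by auto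
  thus ?thesis using msum_Un_disjoint[of "{x \<in> A. Q x}" "{x \<in> A. \<not> Q x}" w] assms by auto
qed

lemma fibre_Times:
  "{x \<in> A \<times> B. (case x of (a, b) \<Rightarrow> v a + w b) = M} =
     (\<Union>p\<in>msplits M. {a \<in> A. v a = fst p} \<times> {b \<in> B. w b = snd p})"
  by (auto simp: msplits_def)

lemma finite_fibres_Times:
  assumes "finite_fibres A v" "finite_fibres B w"
  shows "finite_fibres (A \<times> B) (\<lambda>(a, b). v a + w b)"
  using assms unfolding finite_fibres_def fibre_Times by auto

text \<open>The pairs of weight \<open>M\<close> fall into disjoint rectangles indexed by the
  splittings of \<open>M\<close>, which are the terms of the Cauchy product.\<close>

lemma msum_mult:
  assumes "finite_fibres A v" "finite_fibres B w"
  shows "msum A v * msum B w = msum (A \<times> B) (\<lambda>(a, b). v a + w b)"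
proof (rule mfps_eqI)
  fix M
  have "card {x \<in> A \<times> B. (case x of (a, b) \<Rightarrow> v a + w b) = M} =
      (\<Sum>p\<in>msplits M. card ({a \<in> A. v a = fst p} \<times> {b \<in> B. w b = snd p}))"
    unfolding fibre_Times using assms
    by (intro card_UN_disjoint) (auto simp: finite_fibres_def)
  thus "mcoeff (msum A v * msum B w) M = mcoeff (msum (A \<times> B) (\<lambda>(a, b). v a + w b)) M"
    by (simp add: mcoeff_mult mcoeff_msum card_cartesian_product case_prod_unfold)
qed

lemma finite_fibres_mset: "finite_fibres A mset"
  unfolding finite_fibres_def
proof
  fix M :: "nat multiset"
  show "finite {xs \<in> A. mset xs = M}"
    by (rule finite_subset[OF _ finite_lists_length_eq[of "set_mset M" "size M"]]) auto
qed

lemma finite_fibres_mset_set: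
  assumes "\<And>S. S \<in> A \<Longrightarrow> finite S"
  shows "finite_fibres A mset_set"
  unfolding finite_fibres_def
proof
  fix M :: "nat multiset"
  show "finite {S \<in> A. mset_set S = M}"
    by (rule finite_subset[of _ "Pow (set_mset M)"]) (use assms in auto)
qed


section \<open>Words coding the colourings of paths and tadpoles\<close>

definition path_words :: "nat \<Rightarrow> nat list set" where
  "path_words n = {xs. length xs = n \<and> set xs \<subseteq> {1..} \<and> successively (\<noteq>) xs}"

text \<open>All tadpole edges except the one closing the cycle form a single path through all
  vertices. A tadpole is thus a path with one extra edge, between its first and \<open>a\<close>-th
  vertex, here positions 0 and \<open>a - 1\<close>.\<close>

definition tadpole_words :: "nat \<Rightarrow> nat \<Rightarrow> nat list set" where
  "tadpole_words a n = {xs \<in> path_words n. xs ! 0 \<noteq> xs ! (a - 1)}"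

definition path_fps :: "nat \<Rightarrow> mfps" where
  "path_fps n = msum (path_words n) mset"

text \<open>\<open>tadpole_fps a n\<close> belongs to the tadpole with \<open>n\<close> vertices in total, \<open>a\<close> of them on the
  cycle; for \<open>a = n\<close> it is the cycle itself.\<close>

definition tadpole_fps :: "nat \<Rightarrow> nat \<Rightarrow> mfps" where
  "tadpole_fps a n = msum (tadpole_words a n) mset"

lemma path_fps_0: "path_fps 0 = 1"
proof -
  have *: "path_words 0 = {[]}" by (auto simp: path_words_def)
  show ?thesis unfolding path_fps_def * by (rule mfps_eqI) (auto simp: mcoeff_msum mcoeff_1)
qed

text \<open>The closing condition compares the first letter with itself. This degenerate case starts
  the induction on the cycle length.\<close>

lemma tadpole_fps_1: "tadpole_fps (Suc 0) n = 0"
  by (simp add: tadpole_fps_def tadpole_words_def)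

text \<open>Cutting the tail off: if the colours on both sides of the cut agree, reversing the cycle part
  turns the word into a path word violating the condition of the tadpole with the longer cycle.
  This is the triple-deletion property.\<close>

lemma tadpole_fps_Suc:
  assumes "1 \<le> a" "a < n"
  shows "tadpole_fps (Suc a) n =
    tadpole_fps a n - tadpole_fps a a * path_fps (n - a) + path_fps n"
proof -
  let ?w = "\<lambda>(us, vs). mset us + mset vs :: nat multiset"
  let ?A = "tadpole_words a a \<times> path_words (n - a)"
  let ?Q = "\<lambda>(us, vs). last us \<noteq> hd vs"
  have "tadpole_fps a a * path_fps (n - a) = msum ?A ?w"
    unfolding tadpole_fps_def path_fps_def by (rule msum_mult) (rule finite_fibres_mset)+
  also have "\<dots> = msum {x \<in> ?A. ?Q x} ?w + msum {x \<in> ?A. \<not> ?Q x} ?w"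
    by (intro msum_split finite_fibres_Times finite_fibres_mset)
  also have "msum {x \<in> ?A. ?Q x} ?w = tadpole_fps a n"
    unfolding tadpole_fps_def
  proof (rule msum_cong_bij)
    show "bij_betw (\<lambda>(us, vs). us @ vs) {x \<in> ?A. ?Q x} (tadpole_words a n)"
    proof (rule bij_betw_byWitness[where f' = "\<lambda>xs. (take a xs, drop a xs)"])
      show "(\<lambda>xs. (take a xs, drop a xs)) ` tadpole_words a n \<subseteq> {x \<in> ?A. ?Q x}"
      proof safe
        fix xs assume "xs \<in> tadpole_words a n"
        moreover define us vs where "us = take a xs" and "vs = drop a xs"
        ultimately have "us @ vs \<in> tadpole_words a n" "length us = a" "xs = us @ vs"
          using assms by (auto simp: tadpole_words_def path_words_def)
        thus "take a xs \<in> tadpole_words a a" "drop a xs \<in> path_words (n - a)"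
          "last (take a xs) = hd (drop a xs) \<Longrightarrow> False"
          using assms
          by (auto simp: tadpole_words_def path_words_def successively_append_iff nth_append)
      qed
    qed (use assms in \<open>auto simp: tadpole_words_def path_words_def successively_append_iff
          nth_append split: if_splits\<close>)
  qed auto
  \<comment> \<open>In \<open>rev us @ vs\<close> the letters meeting at the junction are
    \<open>hd us\<close> and \<open>hd vs = last us\<close>, distinct by the closing edge of the
    cycle. The letter \<open>last us\<close> moves to position 0 and equals the one at position
    \<open>a\<close>.\<close>
  also have "msum {x \<in> ?A. \<not> ?Q x} ?w = msum {xs \<in> path_words n. xs ! 0 = xs ! a} mset"
  proof (rule msum_cong_bij)
    show "bij_betw (\<lambda>(us, vs). rev us @ vs) {x \<in> ?A. \<not> ?Q x}
        {xs \<in> path_words n. xs ! 0 = xs ! a}"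
    proof (rule bij_betw_byWitness[where f' = "\<lambda>xs. (rev (take a xs), drop a xs)"])
      show "(\<lambda>xs. (rev (take a xs), drop a xs)) ` {xs \<in> path_words n. xs ! 0 = xs ! a}
          \<subseteq> {x \<in> ?A. \<not> ?Q x}"
      proof (rule image_subsetI)
        fix xs assume "xs \<in> {xs \<in> path_words n. xs ! 0 = xs ! a}"
        moreover define us vs where "us = take a xs" and "vs = drop a xs"
        ultimately have "us @ vs \<in> path_words n" "length us = a" "xs = us @ vs"
          "hd us = hd vs" "us \<noteq> []" "vs \<noteq> []"
          using assms by (cases xs; auto simp: path_words_def hd_drop_conv_nth)+
        thus "(rev (take a xs), drop a xs) \<in> {x \<in> ?A. \<not> ?Q x}"
          using assms
          by (auto simp: tadpole_words_def path_words_def successively_append_iff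
              successively_rev last_rev rev_nth last_conv_nth hd_conv_nth eq_commute)
      qed
      show "(\<lambda>(us, vs). rev us @ vs) ` {x \<in> ?A. \<not> ?Q x}
          \<subseteq> {xs \<in> path_words n. xs ! 0 = xs ! a}"
      proof (rule image_subsetI)
        fix x assume "x \<in> {x \<in> ?A. \<not> ?Q x}"
        moreover obtain us vs where "x = (us, vs)" by (cases x)
        moreover from calculation have "us \<noteq> []" "vs \<noteq> []"
          using assms by (auto simp: tadpole_words_def path_words_def)
        ultimately show "(case x of (us, vs) \<Rightarrow> rev us @ vs) \<in>
            {xs \<in> path_words n. xs ! 0 = xs ! a}"
          using assms
          by (auto simp: tadpole_words_def path_words_def successively_append_iff
              successively_rev last_rev rev_nth last_conv_nth hd_conv_nth eq_commute nth_append)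
      qed
    qed (use assms in \<open>auto simp: tadpole_words_def path_words_def\<close>)
  qed auto
  finally have "tadpole_fps a a * path_fps (n - a) =
      tadpole_fps a n + msum {xs \<in> path_words n. xs ! 0 = xs ! a} mset" .
  moreover have "path_fps n =
      msum {xs \<in> path_words n. xs ! 0 = xs ! a} mset + tadpole_fps (Suc a) n"
    using msum_split[OF finite_fibres_mset, of "path_words n" "\<lambda>xs. xs ! 0 = xs ! a"]
    by (simp add: path_fps_def tadpole_fps_def tadpole_words_def)
  ultimately show ?thesis by (simp add: algebra_simps)
qed

text \<open>Telescopes \<open>tadpole_fps_Suc\<close> from \<open>tadpole_fps_1\<close>: enlarging
  the cycle from \<open>j\<close> adds one \<open>path_fps n\<close> and subtracts one product of a
  cycle and a path.\<close>

lemma tadpole_fps_eq: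
  assumes "1 \<le> a" "a \<le> n"
  shows "tadpole_fps a n =
    of_nat (a - 1) * path_fps n - (\<Sum>j = 1..<a. tadpole_fps j j * path_fps (n - j))"
  using assms
proof (induction a rule: dec_induct)
  case base
  show ?case by (simp add: tadpole_fps_1)
next
  case (step a)
  from step.hyps have a: "of_nat (Suc a - 1) = (of_nat (a - 1) + 1 :: mfps)"
    by (metis add.commute diff_Suc_1 le_add_diff_inverse of_nat_1 of_nat_add)
  have "tadpole_fps (Suc a) n =
      tadpole_fps a n - tadpole_fps a a * path_fps (n - a) + path_fps n"
    using step by (intro tadpole_fps_Suc) auto
  also have "tadpole_fps a n =
      of_nat (a - 1) * path_fps n - (\<Sum>j = 1..<a. tadpole_fps j j * path_fps (n - j))"
    using step by simp
  finally show ?case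
    unfolding a sum.atLeastLessThan_Suc[OF step.hyps(1)] by (simp only: algebra_simps mult_1)
qed


section \<open>The recurrence for paths\<close>

definition esym_sets :: "nat \<Rightarrow> nat set set" where
  "esym_sets k = {S. finite S \<and> S \<subseteq> {1..} \<and> card S = k}"

definition pair_weight :: "nat set \<times> nat list \<Rightarrow> nat multiset" where
  "pair_weight = (\<lambda>(S, xs). mset_set S + mset xs)"

definition pairs_in :: "nat \<Rightarrow> nat \<Rightarrow> (nat set \<times> nat list) set" where
  "pairs_in k m = {(S, xs). S \<in> esym_sets k \<and> xs \<in> path_words m \<and> xs \<noteq> [] \<and> hd xs \<in> S}"

definition pairs_out :: "nat \<Rightarrow> nat \<Rightarrow> (nat set \<times> nat list) set" where
  "pairs_out k m = {(S, xs). S \<in> esym_sets k \<and> xs \<in> path_words m \<and> xs \<noteq> [] \<and> hd xs \<notin> S}"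

lemma finite_fibres_esym_sets: "finite_fibres (esym_sets k) mset_set"
  by (rule finite_fibres_mset_set) (simp add: esym_sets_def)

lemma finite_fibres_pairs: "finite_fibres (esym_sets k \<times> path_words m) pair_weight"
  unfolding pair_weight_def
  by (intro finite_fibres_Times finite_fibres_esym_sets finite_fibres_mset)

lemma esym_mult_path_fps: "esym k * path_fps m = msum (esym_sets k \<times> path_words m) pair_weight"
  unfolding path_fps_def esym_def esym_sets_def[symmetric] pair_weight_def
  by (intro msum_mult finite_fibres_esym_sets finite_fibres_mset)

lemma esym_mult_path_fps_split:
  assumes "m \<ge> 1"
  shows "esym k * path_fps m = msum (pairs_in k m) pair_weight + msum (pairs_out k m) pair_weight"
proof -
  have "pairs_in k m = {x \<in> esym_sets k \<times> path_words m. hd (snd x) \<in> fst x}"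
    "pairs_out k m = {x \<in> esym_sets k \<times> path_words m. \<not> hd (snd x) \<in> fst x}"
    using assms by (auto simp: pairs_in_def pairs_out_def path_words_def)
  thus ?thesis
    using msum_split[OF finite_fibres_pairs, of k m "\<lambda>x. hd (snd x) \<in> fst x"]
    by (simp only: esym_mult_path_fps)
qed

text \<open>The factor \<open>k\<close> becomes the choice of a marked element of the set
  component.\<close>

lemma of_nat_mult_msum_marked:
  fixes B :: "(nat set \<times> 'k) set"
  assumes "finite_fibres B w" "\<And>x. x \<in> B \<Longrightarrow> finite (fst x) \<and> card (fst x) = k"
  shows "of_nat k * msum B w = msum (SIGMA x:B. fst x) (\<lambda>(x, s). w x)"
proof (rule mfps_eqI)
  fix M
  have eq: "{y \<in> (SIGMA x:B. fst x). (case y of (x, s) \<Rightarrow> w x) = M} =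
      (SIGMA x:{x \<in> B. w x = M}. fst x)"
    by auto
  have "card (SIGMA x:{x \<in> B. w x = M}. fst x) = (\<Sum>x\<in>{x \<in> B. w x = M}. card (fst x))"
    using assms by (intro card_SigmaI) (auto simp: finite_fibres_def)
  also have "\<dots> = card {x \<in> B. w x = M} * k"
    using assms(2) by simp
  finally have card: "card (SIGMA x:{x \<in> B. w x = M}. fst x) = card {x \<in> B. w x = M} * k" .
  have "mcoeff (of_nat k * msum B w) M = int k * mcoeff (msum B w) M"
    using mcoeff_of_int_mult[of "int k"] by simp
  thus "mcoeff (of_nat k * msum B w) M = mcoeff (msum (SIGMA x:B. fst x) (\<lambda>(x, s). w x)) M"
    unfolding mcoeff_msum eq card by simp
qed

text \<open>A marked element of \<open>S\<close> either is the first letter of the word, in which case the mark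
  is redundant, or can be moved from \<open>S\<close> to the front of the word.\<close>

lemma of_nat_mult_esym_mult_path_fps:
  "of_nat (Suc k) * (esym (Suc k) * path_fps m) =
     msum (pairs_in (Suc k) m) pair_weight + msum (pairs_out k (Suc m)) pair_weight"
proof -
  let ?B = "esym_sets (Suc k) \<times> path_words m"
  let ?A = "SIGMA x:?B. fst x"
  let ?w = "\<lambda>(x, s :: nat). pair_weight x"
  let ?Q = "\<lambda>(x :: nat set \<times> nat list, s). snd x \<noteq> [] \<and> s = hd (snd x)"
  have fin: "finite_fibres ?A ?w"
    unfolding finite_fibres_def
  proof
    fix M
    have "{y \<in> ?A. ?w y = M} = (SIGMA x:{x \<in> ?B. pair_weight x = M}. fst x)" by auto
    moreover have "finite \<dots>"
      using finite_fibres_pairs[of "Suc k" m]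
      by (intro finite_SigmaI) (auto simp: finite_fibres_def esym_sets_def)
    ultimately show "finite {y \<in> ?A. ?w y = M}" by simp
  qed
  have "of_nat (Suc k) * (esym (Suc k) * path_fps m) = msum ?A ?w"
    unfolding esym_mult_path_fps
    by (rule of_nat_mult_msum_marked[OF finite_fibres_pairs]) (auto simp: esym_sets_def)
  also have "\<dots> = msum {y \<in> ?A. ?Q y} ?w + msum {y \<in> ?A. \<not> ?Q y} ?w"
    by (rule msum_split[OF fin])
  also have "msum {y \<in> ?A. ?Q y} ?w = msum (pairs_in (Suc k) m) pair_weight"
  proof (rule msum_cong_bij)
    show "bij_betw fst {y \<in> ?A. ?Q y} (pairs_in (Suc k) m)"
      by (rule bij_betw_byWitness[where f' = "\<lambda>x. (x, hd (snd x))"]) (auto simp: pairs_in_def)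
  qed auto
  also have "msum {y \<in> ?A. \<not> ?Q y} ?w = msum (pairs_out k (Suc m)) pair_weight"
  proof (rule msum_cong_bij)
    \<comment> \<open>Since \<open>s\<close> differs from the head of \<open>xs\<close>, or
      \<open>xs\<close> is empty, \<open>s # xs\<close> is still proper. Its head is not in
      \<open>S - {s}\<close>, and it records the mark for the inverse.\<close>
    show "bij_betw (\<lambda>((S, xs), s). (S - {s}, s # xs)) {y \<in> ?A. \<not> ?Q y} (pairs_out k (Suc m))"
    proof (rule bij_betw_byWitness[where f' = "\<lambda>(S, xs). ((insert (hd xs) S, tl xs), hd xs)"])
      show "(\<lambda>((S, xs), s). (S - {s}, s # xs)) ` {y \<in> ?A. \<not> ?Q y} \<subseteq> pairs_out k (Suc m)"
        by (auto simp: pairs_out_def esym_sets_def path_words_def successively_Cons)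
      show "(\<lambda>(S, xs). ((insert (hd xs) S, tl xs), hd xs)) ` pairs_out k (Suc m)
          \<subseteq> {y \<in> ?A. \<not> ?Q y}"
      proof (rule image_subsetI)
        fix x assume "x \<in> pairs_out k (Suc m)"
        moreover from this obtain S s ys where "x = (S, s # ys)"
          by (auto simp: pairs_out_def neq_Nil_conv)
        ultimately show "(case x of (S, xs) \<Rightarrow> ((insert (hd xs) S, tl xs), hd xs)) \<in>
            {y \<in> ?A. \<not> ?Q y}"
          by (auto simp: pairs_out_def esym_sets_def path_words_def successively_Cons)
      qed
    qed (auto simp: pairs_out_def)
    fix y assume "y \<in> {y \<in> ?A. \<not> ?Q y}"
    thus "pair_weight ((\<lambda>((S, xs), s). (S - {s}, s # xs)) y) = ?w y"
      by (auto simp: pair_weight_def esym_sets_def mset_set.remove)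
  qed
  finally show ?thesis .
qed

lemma esym_0: "esym 0 = 1"
proof -
  have *: "{S. finite S \<and> S \<subseteq> {1::nat..} \<and> card S = 0} = {{}}" by auto
  show ?thesis unfolding esym_def *
    by (rule mfps_eqI) (auto simp: mcoeff_msum mcoeff_1 cong: conj_cong)
qed

text \<open>Each product with \<open>k < n\<close> splits into in- and out-pairs, while the
  \<open>k\<close>-fold product gives in-pairs at \<open>k\<close> and out-pairs at
  \<open>k - 1\<close>. Summing and shifting the out-pairs equates the sum of
  \<open>esym k * path_fps (n - k)\<close> over \<open>k < n\<close> with the sum of its
  \<open>k\<close>-fold multiples over \<open>k\<close> from 1 to \<open>n\<close>. The term
  \<open>k = 0\<close> on the left is \<open>path_fps n\<close>; removing one copy of each product
  on the right leaves the factors \<open>k - 1\<close>.\<close>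

lemma path_fps_rec:
  assumes "n \<ge> 1"
  shows "path_fps n = esym n + (\<Sum>k = 1..n. of_nat (k - 1) * esym k * path_fps (n - k))"
proof -
  let ?I = "\<lambda>k. msum (pairs_in k (n - k)) pair_weight"
  let ?O = "\<lambda>k. msum (pairs_out k (n - k)) pair_weight"
  have marked: "of_nat k * (esym k * path_fps (n - k)) = ?I k + ?O (k - 1)" if "k \<in> {1..n}" for k
    using that of_nat_mult_esym_mult_path_fps[of "k - 1" "n - k"] by (simp add: Suc_diff_le)
  \<comment> \<open>The empty set contains no head, and the empty word has none; this lets the range
    of the in-pairs be shifted to start at 1.\<close>
  have I0: "?I 0 = 0" and In: "?I n = 0"
  proof -
    have "pairs_in 0 n = {}" "pairs_in n 0 = {}"
      by (auto simp: pairs_in_def esym_sets_def path_words_def)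
    thus "?I 0 = 0" "?I n = 0" by simp_all
  qed
  have "(\<Sum>k = 0..<n. esym k * path_fps (n - k)) = (\<Sum>k = 0..<n. ?I k) + (\<Sum>k = 0..<n. ?O k)"
    by (simp add: esym_mult_path_fps_split sum.distrib)
  also have "(\<Sum>k = 0..<n. ?O k) = (\<Sum>k = 1..n. ?O (k - 1))"
    by (rule sum.reindex_bij_witness[where i = "\<lambda>k. k - 1" and j = Suc]) auto
  also have "(\<Sum>k = 0..<n. ?I k) = (\<Sum>k = 0..n. ?I k)"
    using In by (simp add: sum.last_plus)
  also have "\<dots> = (\<Sum>k = 1..n. ?I k)"
    using I0 by (simp add: sum.atLeast_Suc_atMost)
  also have "(\<Sum>k = 1..n. ?I k) + (\<Sum>k = 1..n. ?O (k - 1)) =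
      (\<Sum>k = 1..n. of_nat k * (esym k * path_fps (n - k)))"
    by (simp only: sum.distrib[symmetric]) (rule sum.cong, use marked in auto)
  finally have *: "(\<Sum>k = 0..<n. esym k * path_fps (n - k)) =
      (\<Sum>k = 1..n. of_nat k * (esym k * path_fps (n - k)))" .
  have "(\<Sum>k = 1..n. of_nat k * (esym k * path_fps (n - k))) =
      (\<Sum>k = 1..n. of_nat (k - 1) * esym k * path_fps (n - k)) +
      (\<Sum>k = 1..n. esym k * path_fps (n - k))"
    unfolding sum.distrib[symmetric]
    by (rule sum.cong) (auto simp: of_nat_diff algebra_simps)
  moreover have "(\<Sum>k = 1..n. esym k * path_fps (n - k)) =
      (\<Sum>k = 1..<n. esym k * path_fps (n - k)) + esym n"
    using assms by (simp add: sum.last_plus path_fps_0)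
  moreover have "(\<Sum>k = 0..<n. esym k * path_fps (n - k)) =
      path_fps n + (\<Sum>k = 1..<n. esym k * path_fps (n - k))"
    using assms by (simp add: sum.atLeast_Suc_lessThan esym_0)
  ultimately show ?thesis using * by (simp add: algebra_simps)
qed


section \<open>The recurrence for tadpoles\<close>

text \<open>Expand every tadpole by \<open>tadpole_fps_eq\<close> and write its factor
  \<open>a - k - 1\<close> as \<open>(a - 1) - k\<close>. By the cycle recurrence, the terms with
  factor \<open>k\<close> and the double sum of cycles together form the sum that
  \<open>tadpole_fps_eq\<close> subtracts for \<open>tadpole_fps a n\<close>. What remains is
  \<open>a - 1\<close> times the path recurrence, cut at \<open>a\<close>. Assuming
  \<open>cycle\<close> only below \<open>a\<close> lets the case \<open>n = a\<close> prove the
  cycle recurrence itself.\<close>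

lemma tadpole_fps_rec_if_cycle_rec:
  assumes "1 \<le> a" "a \<le> n"
    and cycle: "\<And>m. 1 \<le> m \<Longrightarrow> m < a \<Longrightarrow> tadpole_fps m m =
      of_nat m * of_nat (m - 1) * esym m +
      (\<Sum>k = 1..<m. of_nat (k - 1) * esym k * tadpole_fps (m - k) (m - k))"
  shows "tadpole_fps a n =
    (\<Sum>k = 1..<a. of_nat (k - 1) * esym k * tadpole_fps (a - k) (n - k)) +
    of_nat (a - 1) * (esym n + (\<Sum>k = a..n. of_nat (k - 1) * esym k * path_fps (n - k)))"
proof -
  let ?f = "\<lambda>k. of_nat (k - 1) * esym k"
  let ?c = "\<lambda>j. tadpole_fps j j"
  let ?p = path_fps
  let ?S = "\<Sum>k = 1..<a. \<Sum>j = 1..<a - k. ?f k * ?c j * ?p (n - k - j)"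
  have "(\<Sum>k = 1..<a. ?f k * tadpole_fps (a - k) (n - k)) =
      (\<Sum>k = 1..<a. of_nat (a - 1) * (?f k * ?p (n - k)) - of_nat k * ?f k * ?p (n - k)
        - (\<Sum>j = 1..<a - k. ?f k * ?c j * ?p (n - k - j)))"
  proof (rule sum.cong[OF refl])
    fix k assume k: "k \<in> {1..<a}"
    have 1: "of_nat (a - k - 1) = (of_nat (a - 1) - of_nat k :: mfps)"
      using k by (subst of_nat_diff[symmetric]) (auto simp: diff_right_commute)
    have 2: "tadpole_fps (a - k) (n - k) = of_nat (a - k - 1) * ?p (n - k) -
        (\<Sum>j = 1..<a - k. ?c j * ?p (n - k - j))"
      using k assms(2) by (intro tadpole_fps_eq) auto
    show "?f k * tadpole_fps (a - k) (n - k) =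
        of_nat (a - 1) * (?f k * ?p (n - k)) - of_nat k * ?f k * ?p (n - k)
        - (\<Sum>j = 1..<a - k. ?f k * ?c j * ?p (n - k - j))"
      unfolding 2 1
      by (simp add: left_diff_distrib right_diff_distrib sum_distrib_left mult_ac)
  qed
  also have "\<dots> = of_nat (a - 1) * (\<Sum>k = 1..<a. ?f k * ?p (n - k))
      - (\<Sum>k = 1..<a. of_nat k * ?f k * ?p (n - k)) - ?S"
    by (simp add: sum_subtractf sum_distrib_left)
  finally have L: "(\<Sum>k = 1..<a. ?f k * tadpole_fps (a - k) (n - k)) = \<dots>" .
  have "?S = (\<Sum>(k, j)\<in>(SIGMA k:{1..<a}. {1..<a - k}). ?f k * ?c j * ?p (n - k - j))"
    by (rule sum.Sigma) auto
  \<comment> \<open>Group by \<open>m = k + j\<close>, the number of vertices missing from the path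
    factor.\<close>
  also have "\<dots> = (\<Sum>(m, k)\<in>(SIGMA m:{1..<a}. {1..<m}). ?f k * ?c (m - k) * ?p (n - m))"
    by (rule sum.reindex_bij_witness[where
          i = "\<lambda>(m, k). (k, m - k)" and j = "\<lambda>(k, j). (k + j, k)"]) auto
  also have "\<dots> = (\<Sum>m = 1..<a. \<Sum>k = 1..<m. ?f k * ?c (m - k) * ?p (n - m))"
    by (rule sum.Sigma[symmetric]) auto
  finally have S: "?S = \<dots>" .
  have "(\<Sum>m = 1..<a. ?c m * ?p (n - m)) =
      (\<Sum>m = 1..<a. of_nat m * ?f m * ?p (n - m) +
        (\<Sum>k = 1..<m. ?f k * ?c (m - k) * ?p (n - m)))"
  proof (rule sum.cong[OF refl])
    fix m assume "m \<in> {1..<a}"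
    hence "?c m = of_nat m * of_nat (m - 1) * esym m + (\<Sum>k = 1..<m. ?f k * ?c (m - k))"
      by (intro cycle) auto
    thus "?c m * ?p (n - m) = of_nat m * ?f m * ?p (n - m) +
        (\<Sum>k = 1..<m. ?f k * ?c (m - k) * ?p (n - m))"
      by (simp only: distrib_right sum_distrib_right mult.assoc)
  qed
  also have "\<dots> = (\<Sum>k = 1..<a. of_nat k * ?f k * ?p (n - k)) + ?S"
    unfolding S by (rule sum.distrib)
  finally have R: "(\<Sum>m = 1..<a. ?c m * ?p (n - m)) = \<dots>" .
  have "{1..n} = {1..<a} \<union> {a..n}" using assms by auto
  hence "(\<Sum>k = 1..n. ?f k * ?p (n - k)) =
      (\<Sum>k = 1..<a. ?f k * ?p (n - k)) + (\<Sum>k = a..n. ?f k * ?p (n - k))"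
    by (simp only:) (rule sum.union_disjoint, auto)
  hence P: "?p n = esym n + ((\<Sum>k = 1..<a. ?f k * ?p (n - k)) + (\<Sum>k = a..n. ?f k * ?p (n - k)))"
    using path_fps_rec[of n] assms by simp
  show ?thesis
    unfolding tadpole_fps_eq[OF assms(1,2)] R L by (subst P) (simp only: algebra_simps)
qed

text \<open>For \<open>n = a = m\<close> the last sum has the single term
  \<open>(m - 1) * esym m\<close>, so the total factor of \<open>esym m\<close> is
  \<open>(m - 1) * (1 + (m - 1))\<close>.\<close>

lemma cycle_fps_rec:
  assumes "1 \<le> m"
  shows "tadpole_fps m m = of_nat m * of_nat (m - 1) * esym m +
    (\<Sum>k = 1..<m. of_nat (k - 1) * esym k * tadpole_fps (m - k) (m - k))"
  using assms
proof (induction m rule: less_induct)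
  case (less m)
  have m: "of_nat m = (of_nat (m - 1) + 1 :: mfps)"
    using less.prems by (metis add.commute le_add_diff_inverse of_nat_1 of_nat_add)
  have "tadpole_fps m m =
      (\<Sum>k = 1..<m. of_nat (k - 1) * esym k * tadpole_fps (m - k) (m - k)) +
      of_nat (m - 1) * (esym m + (\<Sum>k = m..m. of_nat (k - 1) * esym k * path_fps (m - k)))"
    using less by (intro tadpole_fps_rec_if_cycle_rec) auto
  thus ?case by (simp add: path_fps_0 m algebra_simps)
qed

lemmas tadpole_fps_rec = tadpole_fps_rec_if_cycle_rec[OF _ _ cycle_fps_rec]


section \<open>Positivity\<close>

text \<open>Listing the partitions with repetition, instead of giving coefficients, makes addition a
  multiset union and multiplication by \<open>esym k\<close> the insertion of a part
  \<open>k\<close>.\<close>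

definition esym_sum :: "mfps \<Rightarrow> bool" where
  "esym_sum f \<longleftrightarrow> (\<exists>N. (\<forall>\<rho>\<in>#N. is_partition \<rho>) \<and> f = (\<Sum>\<rho>\<in>#N. esym_part \<rho>))"

lemma e_positive_if_esym_sum:
  assumes "esym_sum f"
  shows "e_positive f"
proof -
  obtain N where N: "\<forall>\<rho>\<in>#N. is_partition \<rho>" "f = (\<Sum>\<rho>\<in>#N. esym_part \<rho>)"
    using assms by (auto simp: esym_sum_def)
  have "(\<Sum>\<rho>\<in>#N. esym_part \<rho>) = (\<Sum>\<rho>\<in>set_mset N. of_int (int (count N \<rho>)) * esym_part \<rho>)"
  proof (induction N)
    case (add \<rho> N)
    \<comment> \<open>Summing over \<open>insert\<close> avoids a case distinction: if
      \<open>\<rho>\<close> is not in \<open>N\<close>, its count in \<open>N\<close> is 0 and the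
      extra term vanishes.\<close>
    have "(\<Sum>\<mu>\<in>set_mset (add_mset \<rho> N). of_int (int (count (add_mset \<rho> N) \<mu>)) * esym_part \<mu>) =
        (\<Sum>\<mu>\<in>insert \<rho> (set_mset N). (if \<mu> = \<rho> then esym_part \<mu> else 0) +
          of_int (int (count N \<mu>)) * esym_part \<mu>)"
      by (rule sum.cong) (auto simp: distrib_right)
    also have "\<dots> = esym_part \<rho> +
        (\<Sum>\<mu>\<in>insert \<rho> (set_mset N). of_int (int (count N \<mu>)) * esym_part \<mu>)"
      by (simp only: sum.distrib) simp
    also have "(\<Sum>\<mu>\<in>insert \<rho> (set_mset N). of_int (int (count N \<mu>)) * esym_part \<mu>) =
        (\<Sum>\<mu>\<in>set_mset N. of_int (int (count N \<mu>)) * esym_part \<mu>)"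
      by (rule sum.mono_neutral_right) (auto simp: not_in_iff)
    finally show ?case using add.IH by simp
  qed simp
  hence "e_expansion f (\<lambda>\<rho>. int (count N \<rho>))"
    using N by (simp add: e_expansion_def set_mset_def[symmetric])
  thus ?thesis unfolding e_positive_def by (intro exI[of _ "\<lambda>\<rho>. int (count N \<rho>)"]) simp
qed

lemma esym_sum_0: "esym_sum 0"
  unfolding esym_sum_def by (rule exI[of _ "{#}"]) simp

lemma esym_sum_1: "esym_sum 1"
  unfolding esym_sum_def by (rule exI[of _ "{#{#}#}"]) (simp add: is_partition_def esym_part_def)

lemma esym_sum_add: "esym_sum f \<Longrightarrow> esym_sum g \<Longrightarrow> esym_sum (f + g)"
  unfolding esym_sum_def
proof (elim exE conjE)
  fix N N'
  assume "\<forall>\<rho>\<in>#N. is_partition \<rho>" "f = (\<Sum>\<rho>\<in>#N. esym_part \<rho>)"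
    "\<forall>\<rho>\<in>#N'. is_partition \<rho>" "g = (\<Sum>\<rho>\<in>#N'. esym_part \<rho>)"
  thus "\<exists>N. (\<forall>\<rho>\<in>#N. is_partition \<rho>) \<and> f + g = (\<Sum>\<rho>\<in>#N. esym_part \<rho>)"
    by (intro exI[of _ "N + N'"]) auto
qed

lemma esym_sum_sum: "(\<And>x. x \<in> A \<Longrightarrow> esym_sum (f x)) \<Longrightarrow> esym_sum (sum f A)"
  by (induction A rule: infinite_finite_induct) (auto intro: esym_sum_0 esym_sum_add)

lemma esym_sum_of_nat_mult: "esym_sum f \<Longrightarrow> esym_sum (of_nat k * f)"
  by (induction k) (auto simp: distrib_right intro: esym_sum_0 esym_sum_add)

text \<open>The condition \<open>k \<ge> 1\<close> keeps the enlarged multisets free of the part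
  0.\<close>

lemma esym_sum_esym_mult:
  assumes "k \<ge> 1" "esym_sum f"
  shows "esym_sum (esym k * f)"
proof -
  obtain N where N: "\<forall>\<rho>\<in>#N. is_partition \<rho>" "f = (\<Sum>\<rho>\<in>#N. esym_part \<rho>)"
    using assms by (auto simp: esym_sum_def)
  hence "esym k * f = (\<Sum>\<rho>\<in>#image_mset (add_mset k) N. esym_part \<rho>)"
    by (simp add: sum_mset_distrib_left esym_part_def multiset.map_comp comp_def)
  moreover have "\<forall>\<rho>\<in>#image_mset (add_mset k) N. is_partition \<rho>"
    using N assms(1) by (auto simp: is_partition_def)
  ultimately show ?thesis unfolding esym_sum_def by blast
qed

lemma esym_sum_esym: "k \<ge> 1 \<Longrightarrow> esym_sum (esym k)"
  using esym_sum_esym_mult[OF _ esym_sum_1] by simp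

lemma esym_sum_path_fps: "esym_sum (path_fps n)"
proof (induction n rule: less_induct)
  case (less n)
  show ?case
  proof (cases "n = 0")
    case True
    thus ?thesis by (simp add: path_fps_0 esym_sum_1)
  next
    case False
    hence "path_fps n = esym n + (\<Sum>k = 1..n. of_nat (k - 1) * (esym k * path_fps (n - k)))"
      using path_fps_rec[of n] by (simp add: mult.assoc)
    moreover have "esym_sum \<dots>"
      using False less
      by (intro esym_sum_add esym_sum_sum esym_sum_of_nat_mult esym_sum_esym_mult esym_sum_esym) auto
    ultimately show ?thesis by simp
  qed
qed

lemma esym_sum_tadpole_fps:
  assumes "1 \<le> a" "a \<le> n"
  shows "esym_sum (tadpole_fps a n)"
  using assms
proof (induction a arbitrary: n rule: less_induct)
  case (less a)
  have "tadpole_fps a n =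
      (\<Sum>k = 1..<a. of_nat (k - 1) * (esym k * tadpole_fps (a - k) (n - k))) +
      of_nat (a - 1) * (esym n + (\<Sum>k = a..n. of_nat (k - 1) * (esym k * path_fps (n - k))))"
    using tadpole_fps_rec[OF less.prems] by (simp add: mult.assoc)
  moreover have "esym_sum \<dots>"
    using less
    by (intro esym_sum_add esym_sum_sum esym_sum_of_nat_mult esym_sum_esym_mult esym_sum_esym
        esym_sum_path_fps) auto
  ultimately show ?case by simp
qed


section \<open>Colourings of tadpole graphs\<close>

lemma proper_colorings_tadpole:
  assumes "a \<ge> 3" "b \<ge> 1"
  shows "proper_colorings (tadpole a b) =
    {\<kappa> \<in> {1..a + b} \<rightarrow>\<^sub>E {1..}. \<kappa> 1 \<noteq> \<kappa> a \<and> (\<forall>i. 1 \<le> i \<and> i < a + b \<longrightarrow> \<kappa> i \<noteq> \<kappa> (Suc i))}"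
proof -
  let ?f = "\<lambda>i :: nat. {i, Suc i}"
  have "snd (tadpole a b) = {{a, 1}} \<union> (?f ` {1..<a} \<union> ?f ` {a + 1..<a + b} \<union> ?f ` {a})"
    by (auto simp: tadpole_def)
  also have "?f ` {1..<a} \<union> ?f ` {a + 1..<a + b} \<union> ?f ` {a} =
      ?f ` ({1..<a} \<union> {a + 1..<a + b} \<union> {a})"
    by (simp only: image_Un)
  also have "{1..<a} \<union> {a + 1..<a + b} \<union> {a} = {1..<a + b}"
    using assms by auto
  finally have edges: "snd (tadpole a b) = {{a, 1}} \<union> ?f ` {1..<a + b}" .
  have "(\<forall>u v. {u, v} \<in> snd (tadpole a b) \<longrightarrow> \<kappa> u \<noteq> \<kappa> v) \<longleftrightarrow>
      \<kappa> 1 \<noteq> \<kappa> a \<and> (\<forall>i. 1 \<le> i \<and> i < a + b \<longrightarrow> \<kappa> i \<noteq> \<kappa> (Suc i))" (is "?L \<longleftrightarrow> ?R")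
    for \<kappa> :: "nat \<Rightarrow> nat"
  proof
    assume L: ?L
    have "{a, 1} \<in> snd (tadpole a b)" "\<And>i. 1 \<le> i \<Longrightarrow> i < a + b \<Longrightarrow> {i, Suc i} \<in> snd (tadpole a b)"
      by (auto simp: edges)
    with L show ?R by metis
  next
    assume R: ?R
    show ?L
    proof (intro allI impI)
      fix u v assume "{u, v} \<in> snd (tadpole a b)"
      then consider "{u, v} = {a, 1}" | i where "1 \<le> i" "i < a + b" "{u, v} = {i, Suc i}"
        by (auto simp: edges)
      thus "\<kappa> u \<noteq> \<kappa> v" using R by cases (metis doubleton_eq_iff)+
    qed
  qed
  thus ?thesis
    unfolding proper_colorings_def by (simp add: tadpole_def)
qed

lemma chromatic_symmetric_function_tadpole:
  assumes "a \<ge> 3" "b \<ge> 1"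
  shows "chromatic_symmetric_function (tadpole a b) = tadpole_fps a (a + b)"
  unfolding chromatic_symmetric_function_def tadpole_fps_def
proof (rule msum_cong_bij)
  let ?n = "a + b"
  show "bij_betw (\<lambda>\<kappa>. map \<kappa> [1..<Suc ?n]) (proper_colorings (tadpole a b)) (tadpole_words a ?n)"
    unfolding proper_colorings_tadpole[OF assms]
  \<comment> \<open>Vertices count from 1 and list positions from 0. The restriction makes the
    colouring \<open>undefined\<close> off the vertex set, as the extensional function space
    demands.\<close>
  proof (rule bij_betw_byWitness[where f' = "\<lambda>xs. \<lambda>i\<in>{1..?n}. xs ! (i - 1)"])
    show "\<forall>xs\<in>tadpole_words a ?n. map (\<lambda>i\<in>{1..?n}. xs ! (i - 1)) [1..<Suc ?n] = xs"
      by (auto simp: tadpole_words_def path_words_def intro!: nth_equalityI simp del: upt_Suc)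
    show "(\<lambda>\<kappa>. map \<kappa> [1..<Suc ?n]) ` {\<kappa> \<in> {1..?n} \<rightarrow>\<^sub>E {1..}. \<kappa> 1 \<noteq> \<kappa> a \<and>
        (\<forall>i. 1 \<le> i \<and> i < ?n \<longrightarrow> \<kappa> i \<noteq> \<kappa> (Suc i))} \<subseteq> tadpole_words a ?n"
      using assms
      by (auto simp: tadpole_words_def path_words_def successively_conv_nth PiE_iff
          simp del: upt_Suc)
    show "(\<lambda>xs. \<lambda>i\<in>{1..?n}. xs ! (i - 1)) ` tadpole_words a ?n \<subseteq>
      {\<kappa> \<in> {1..?n} \<rightarrow>\<^sub>E {1..}. \<kappa> 1 \<noteq> \<kappa> a \<and> (\<forall>i. 1 \<le> i \<and> i < ?n \<longrightarrow> \<kappa> i \<noteq> \<kappa> (Suc i))}"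
    proof (rule image_subsetI)
      fix xs assume xs: "xs \<in> tadpole_words a ?n"
      let ?\<kappa> = "\<lambda>i\<in>{1..?n}. xs ! (i - 1)"
      have "?\<kappa> \<in> {1..?n} \<rightarrow>\<^sub>E {1..}"
        using xs nth_mem[of _ xs]
        by (auto simp: tadpole_words_def path_words_def subset_iff Ball_def)
      moreover have "?\<kappa> 1 \<noteq> ?\<kappa> a"
        using xs assms by (auto simp: tadpole_words_def)
      moreover have "?\<kappa> i \<noteq> ?\<kappa> (Suc i)" if "1 \<le> i" "i < ?n" for i
        using that xs
        by (cases i) (auto simp: tadpole_words_def path_words_def successively_conv_nth)
      ultimately show "?\<kappa> \<in> {\<kappa> \<in> {1..?n} \<rightarrow>\<^sub>E {1..}. \<kappa> 1 \<noteq> \<kappa> a \<and>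
          (\<forall>i. 1 \<le> i \<and> i < ?n \<longrightarrow> \<kappa> i \<noteq> \<kappa> (Suc i))}"
        by blast
    qed
  qed (auto simp: PiE_iff extensional_def fun_eq_iff simp del: upt_Suc)
  fix \<kappa> :: "nat \<Rightarrow> nat"
  show "mset (map \<kappa> [1..<Suc ?n]) = image_mset \<kappa> (mset_set (fst (tadpole a b)))"
    by (simp add: tadpole_def atLeastLessThanSuc_atLeastAtMost del: upt_Suc)
qed

theorem theorem3p1:
  fixes a b :: nat
  assumes "a \<ge> 3" and "b \<ge> 1"
  shows "e_positive_graph (tadpole a b)"
  unfolding e_positive_graph_def chromatic_symmetric_function_tadpole[OF assms]
  using assms by (intro e_positive_if_esym_sum esym_sum_tadpole_fps) auto

end
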